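(* Let $G$ be a finite, simple, undirected, connected graph with at least two vertices. If $\gamma_t(G) = \frac{1}{2}(\operatorname{diam}(G) + 1)$, then $G$ has a spanning tree $T$ which is a caterpillar and satisfies $\operatorname{diam}(T) = \operatorname{diam}(G)$.
   Context: A set $S \subseteq V(G)$ is a total dominating set of $G$ if every vertex of $G$ (including those in $S$) has a neighbor in $S$; $\gamma_t(G)$ is the minimum cardinality of a total dominating set. $\operatorname{diam}(G)$ denotes the maximum distance between two vertices of $G$. A caterpillar is a tree such that removing all its leaves (vertices of degree one) yields a path. *)

theory Defs
  imports "Graph_Theory.Graph_Theory"
begin

text \<open>
  A finite simple undirected graph is rendered by the locale \<^locale>\<open>graph\<close>: a finite, loop-free,
  symmetric digraph without parallel arcs. An undirected edge is a pair of opposite arcs, so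
  adjacency is \<open>u \<rightarrow>\<^bsub>G\<^esub> v\<close>, and the degree of a vertex is its \<^const>\<open>out_degree\<close>.
\<close>

definition total_dominating_set :: "('a, 'b) pre_digraph \<Rightarrow> 'a set \<Rightarrow> bool" where
  "total_dominating_set G S \<longleftrightarrow> S \<subseteq> verts G \<and> (\<forall>v \<in> verts G. \<exists>u \<in> S. v \<rightarrow>\<^bsub>G\<^esub> u)"

definition total_domination_number :: "('a, 'b) pre_digraph \<Rightarrow> nat" where
  "total_domination_number G = (LEAST k. \<exists>S. total_dominating_set G S \<and> card S = k)"

text \<open>
  The library's shortest-path cost \<^const>\<open>wf_digraph.\<mu>\<close> with unit weights is the usual distance
  (with value \<open>\<infinity>\<close> between different components), hence the type \<^typ>\<open>ereal\<close>.
\<close>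

definition graph_dist :: "('a, 'b) pre_digraph \<Rightarrow> 'a \<Rightarrow> 'a \<Rightarrow> ereal" where
  "graph_dist G u v = wf_digraph.\<mu> G (\<lambda>_. 1) u v"

definition graph_diam :: "('a, 'b) pre_digraph \<Rightarrow> ereal" where
  "graph_diam G = (SUP u \<in> verts G. SUP v \<in> verts G. graph_dist G u v)"

text \<open>
  The library's \<^const>\<open>tree\<close> and \<^const>\<open>spanning_tree\<close> are not usable for symmetric digraphs, since
  there the two arcs of a single edge already form a \<^const>\<open>pre_digraph.cycle\<close>. The cycles of
  the undirected graph are the directed cycles of length at least three.
\<close>

definition undirected_tree :: "('a, 'b) pre_digraph \<Rightarrow> bool" where
  "undirected_tree T \<longleftrightarrow> graph T \<and> Digraph_Component.connected T \<and>
     \<not> (\<exists>p. pre_digraph.cycle T p \<and> 3 \<le> length p)"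

definition undirected_spanning_tree :: "('a, 'b) pre_digraph \<Rightarrow> ('a, 'b) pre_digraph \<Rightarrow> bool" where
  "undirected_spanning_tree T G \<longleftrightarrow> undirected_tree T \<and> spanning T G"

definition leaves :: "('a, 'b) pre_digraph \<Rightarrow> 'a set" where
  "leaves G = {v \<in> verts G. out_degree G v = 1}"

text \<open>
  The list \<open>p\<close> enumerates the vertices along the path. It may be empty, so the null graph
  counts as a path and the tree with two vertices as a caterpillar.
\<close>

definition path_graph :: "('a, 'b) pre_digraph \<Rightarrow> bool" where
  "path_graph P \<longleftrightarrow> graph P \<and>
     (\<exists>p. distinct p \<and> verts P = set p \<and>
          arcs_ends P = set (vwalk_arcs p) \<union> (set (vwalk_arcs p))\<inverse>)"

definition caterpillar :: "('a, 'b) pre_digraph \<Rightarrow> bool" where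
  "caterpillar T \<longleftrightarrow> undirected_tree T \<and> path_graph (T \<restriction> (verts T - leaves T))"

end

theory Submission
  imports Defs
begin

text \<open>
  Let \<open>S\<close> be a minimum total dominating set and sort the vertices into levels by their distance from
  one end of a diametral path. Counting occupied levels shows that the hypothesis leaves no
  slack: \<open>S\<close> has at most one vertex on each level and none on the first and last levels, and two
  levels at distance two are never both occupied. Replacing the vertex of the diametral path on each
  occupied level by the vertex of \<open>S\<close> on that level therefore gives again a path from level \<open>0\<close> to
  level \<open>d\<close>; it contains \<open>S\<close> in its interior, so all other vertices can be attached to it
  as leaves without increasing the diameter.
\<close>

section \<open>Walks, distance and diameter\<close>

lemma relpow_sym:
  assumes "sym r" "(a, b) \<in> r ^^ n"
  shows "(b, a) \<in> r ^^ n"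
  using assms(2)
proof (induction n arbitrary: b)
  case (Suc n)
  then obtain c where "(a, c) \<in> r ^^ n" "(c, b) \<in> r" by auto
  with Suc.IH assms(1) show ?case by (meson relpow_Suc_I2 symD)
qed simp

lemma relpow_mono:
  fixes r :: "('a \<times> 'a) set"
  assumes "r \<subseteq> s"
  shows "r ^^ n \<subseteq> s ^^ n"
  by (induction n) (use assms in auto)

text \<open>Bridge between the library's walks and powers of the adjacency relation, in which
  lengths and symmetry are easier to handle. The case \<open>n = 0\<close> relies on
  \<open>u \<in> verts G\<close>, since even an empty walk has to start in the graph.\<close>

lemma (in wf_digraph) relpow_arcs_ends_iff_awalk:
  assumes "u \<in> verts G"
  shows "(u, v) \<in> arcs_ends G ^^ n \<longleftrightarrow> (\<exists>p. awalk u p v \<and> length p = n)"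
  using assms
proof (induction n arbitrary: u)
  case 0
  then show ?case by (auto simp: awalk_Nil_iff)
next
  case (Suc n)
  show ?case
  proof
    assume "(u, v) \<in> arcs_ends G ^^ Suc n"
    then obtain w where w: "(u, w) \<in> arcs_ends G" "(w, v) \<in> arcs_ends G ^^ n"
      by (meson relpow_Suc_D2)
    then obtain p where "awalk w p v" "length p = n"
      using Suc.IH adj_in_verts(2) by blast
    moreover obtain e where "e \<in> arcs G" "tail G e = u" "head G e = w"
      using w(1) by blast
    ultimately have "awalk u (e # p) v" "length (e # p) = Suc n"
      by (auto simp: awalk_Cons_iff)
    then show "\<exists>p. awalk u p v \<and> length p = Suc n" by blast
  next
    assume "\<exists>p. awalk u p v \<and> length p = Suc n"
    then obtain e p where p: "awalk u (e # p) v" "length p = n"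
      by (metis length_Suc_conv)
    then have "(head G e, v) \<in> arcs_ends G ^^ n" "(u, head G e) \<in> arcs_ends G"
      using Suc.IH[of "head G e"] by (auto simp: awalk_Cons_iff arcs_ends_conv)
    then show "(u, v) \<in> arcs_ends G ^^ Suc n" by (meson relpow_Suc_I2)
  qed
qed

lemma (in wf_digraph) graph_dist_le:
  assumes "u \<in> verts G" "(u, v) \<in> arcs_ends G ^^ n"
  shows "graph_dist G u v \<le> ereal (real n)"
proof -
  obtain p where "awalk u p v" "length p = n"
    using assms relpow_arcs_ends_iff_awalk by blast
  then show ?thesis
    using min_cost_le_walk_cost[of u p v "\<lambda>_. 1"]
    by (simp add: graph_dist_def awalk_cost_def sum_list_triv)
qed

lemma (in wf_digraph) graph_dist_ge:
  assumes "u \<in> verts G" "\<And>n. (u, v) \<in> arcs_ends G ^^ n \<Longrightarrow> m \<le> n"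
  shows "ereal (real m) \<le> graph_dist G u v"
  unfolding graph_dist_def \<mu>_def
proof (rule INF_greatest)
  fix p assume "p \<in> {p. awalk u p v}"
  then have "m \<le> length p"
    using assms relpow_arcs_ends_iff_awalk by blast
  then show "ereal (real m) \<le> ereal (awalk_cost (\<lambda>_. 1) p)"
    by (simp add: awalk_cost_def sum_list_triv)
qed

text \<open>A distance with natural values, so that levels can be counted and used in inductions. If
  no walk exists the value is unspecified; agreement with \<open>graph_dist\<close> is therefore
  shown under connectedness.\<close>

definition hop_dist :: "('a, 'b) pre_digraph \<Rightarrow> 'a \<Rightarrow> 'a \<Rightarrow> nat" where
  "hop_dist G u v = (LEAST n. (u, v) \<in> arcs_ends G ^^ n)"

lemma hop_dist_le: "(u, v) \<in> arcs_ends G ^^ n \<Longrightarrow> hop_dist G u v \<le> n"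
  unfolding hop_dist_def by (rule Least_le)

lemma (in sym_digraph) relpow_hop_dist:
  assumes "Digraph_Component.connected G" "u \<in> verts G" "v \<in> verts G"
  shows "(u, v) \<in> arcs_ends G ^^ hop_dist G u v"
proof -
  have "strongly_connected G"
    using assms(1) sym_arcs by (rule symmetric_connected_imp_strongly_connected[rotated])
  then have "u \<rightarrow>\<^sup>*\<^bsub>G\<^esub> v" using assms(2,3) by (auto simp: strongly_connected_def)
  then obtain n where "(u, v) \<in> arcs_ends G ^^ n"
    by (auto simp: reachable_conv dest: rtrancl_imp_relpow)
  then show ?thesis unfolding hop_dist_def by (rule LeastI)
qed

lemma (in sym_digraph) graph_dist_eq_hop_dist:
  assumes "Digraph_Component.connected G" "u \<in> verts G" "v \<in> verts G"
  shows "graph_dist G u v = ereal (real (hop_dist G u v))"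
  using assms graph_dist_le graph_dist_ge relpow_hop_dist hop_dist_le
  by (metis order_antisym)

text \<open>With finitely many vertices the supremum is a maximum, which supplies a pair at distance
  \<open>d\<close>.\<close>

lemma (in graph) graph_diam_attained:
  assumes "Digraph_Component.connected G"
  obtains d v\<^sub>0 v\<^sub>1 where "graph_diam G = ereal (real d)"
    "v\<^sub>0 \<in> verts G" "v\<^sub>1 \<in> verts G" "hop_dist G v\<^sub>0 v\<^sub>1 = d"
    "\<And>u v. u \<in> verts G \<Longrightarrow> v \<in> verts G \<Longrightarrow> hop_dist G u v \<le> d"
proof -
  define D where "D = (\<lambda>(u, v). hop_dist G u v) ` (verts G \<times> verts G)"
  define d where "d = Max D"
  have "verts G \<noteq> {}"
    using assms by (auto simp: Digraph_Component.connected_def strongly_connected_def)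
  then have "finite D" "D \<noteq> {}" by (auto simp: D_def)
  then have "d \<in> D" and le: "\<And>n. n \<in> D \<Longrightarrow> n \<le> d" by (auto simp: d_def)
  then obtain v\<^sub>0 v\<^sub>1 where v: "v\<^sub>0 \<in> verts G" "v\<^sub>1 \<in> verts G" "hop_dist G v\<^sub>0 v\<^sub>1 = d"
    by (auto simp: D_def)
  have le': "hop_dist G u v \<le> d" if "u \<in> verts G" "v \<in> verts G" for u v
    using that by (intro le) (force simp: D_def)
  have "graph_diam G \<le> ereal (real d)"
    unfolding graph_diam_def
    by (intro SUP_least) (simp add: graph_dist_eq_hop_dist[OF assms] le')
  moreover have "ereal (real d) \<le> graph_diam G"
    unfolding graph_diam_def
    by (intro SUP_upper2[OF v(1)] SUP_upper2[OF v(2)])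
      (simp add: graph_dist_eq_hop_dist[OF assms] v)
  ultimately show thesis using that[OF _ v le'] by auto
qed

lemma (in nomulti_digraph) out_degree_eq_card_Image:
  "out_degree G v = card (arcs_ends G `` {v})"
proof -
  have "arcs_ends G `` {v} = head G ` out_arcs G v"
    by (force simp: arcs_ends_conv)
  moreover have "inj_on (head G) (out_arcs G v)"
    by (rule inj_onI) (auto simp: arc_to_ends_def intro: no_multi_arcs)
  ultimately show ?thesis by (simp add: out_degree_def card_image)
qed

lemma set_vwalk_arcs:
  "set (vwalk_arcs xs) = {(xs ! i, xs ! Suc i) | i. Suc i < length xs}"
proof (induction xs rule: vwalk_arcs.induct)
  case (3 x y xs)
  have "{((x # y # xs) ! i, (x # y # xs) ! Suc i) | i. Suc i < length (x # y # xs)}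
      = insert (x, y) {((y # xs) ! i, (y # xs) ! Suc i) | i. Suc i < length (y # xs)}"
    (is "?A = ?B")
  proof
    show "?A \<subseteq> ?B"
    proof
      fix z assume "z \<in> ?A"
      then obtain i where "z = ((x # y # xs) ! i, (x # y # xs) ! Suc i)" "Suc i < length (x # y # xs)"
        by blast
      then show "z \<in> ?B" by (cases i) auto
    qed
    have "(x, y) \<in> ?A" by (auto intro!: exI[of _ 0])
    moreover have "((y # xs) ! i, (y # xs) ! Suc i) \<in> ?A" if "Suc i < length (y # xs)" for i
      using that by (auto intro!: exI[of _ "Suc i"])
    ultimately show "?B \<subseteq> ?A" by blast
  qed
  with 3 show ?case by simp
qed auto

section \<open>Acyclicity from a rank function\<close>

text \<open>
  A vertex of maximal rank on a cycle would have its cyclic predecessor and successor, which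
  differ once the length is at least three, both equal to its parent.
\<close>

lemma (in wf_digraph) no_long_cycle_if_parent:
  fixes rank :: "'a \<Rightarrow> nat"
  assumes parent: "\<And>u v. u \<rightarrow>\<^bsub>G\<^esub> v \<Longrightarrow>
      (rank u < rank v \<and> u = parent v) \<or> (rank v < rank u \<and> v = parent u)"
    and cyc: "cycle p"
  shows "length p < 3"
proof (rule ccontr)
  define n where "n = length p"
  assume "\<not> length p < 3"
  then have n3: "3 \<le> n" by (simp add: n_def)
  obtain u where u: "awalk u p u" "distinct (tl (awalk_verts u p))" "p \<noteq> []"
    using cyc by (auto simp: cycle_def)
  define w where "w j = head G (p ! j)" for j
  have cas: "cas u p u" using u(1) by blast
  \<comment> \<open>The vertices of the closed walk listed in two ways, by tails and by heads;
    comparing entries shows that each arc starts where the previous one ends.\<close>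
  have verts_eq: "map (tail G) p @ [head G (last p)] = tail G (hd p) # map (head G) p"
    using u(3) awalk_verts_conv[of u p] awalk_verts_conv'[OF cas] by simp
  have dist: "distinct (map (head G) p)"
    using u(2,3) awalk_verts_conv'[OF cas] by simp
  have tail_Suc: "tail G (p ! Suc j) = w j" if "Suc j < n" for j
    using arg_cong[OF verts_eq, of "\<lambda>xs. xs ! Suc j"] that
    by (simp add: nth_append n_def w_def)
  have tail_0: "tail G (p ! 0) = w (n - 1)"
  proof -
    have "tail G (hd p) = u" using cas u(3) by (simp add: cas_simp)
    moreover have "head G (last p) = u"
      using u awalk_verts_conv[of u p] awlast_if_cas[OF cas] by simp
    ultimately show ?thesis using u(3) by (simp add: w_def n_def last_conv_nth hd_conv_nth)
  qed
  have w_inj: "i = j" if "w i = w j" "i < n" "j < n" for i j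
    using dist that by (auto simp: distinct_conv_nth w_def n_def)
  have edge: "tail G (p ! j) \<rightarrow>\<^bsub>G\<^esub> w j" if "j < n" for j
    using u(1) that by (force simp: arcs_ends_conv w_def n_def)
  obtain i where i: "i < n" "\<And>j. j < n \<Longrightarrow> rank (w j) \<le> rank (w i)"
  proof -
    have "finite ((rank \<circ> w) ` {..<n})" "(rank \<circ> w) ` {..<n} \<noteq> {}"
      using n3 by (auto simp: lessThan_empty_iff)
    from Max_in[OF this] obtain i where "i < n" "Max ((rank \<circ> w) ` {..<n}) = rank (w i)"
      by auto
    then show thesis
      by (intro that[of i]) (auto intro!: Max_ge simp flip: \<open>Max _ = _\<close>)
  qed
  define pr where "pr = (if i = 0 then n - 1 else i - 1)"
  define sc where "sc = (if Suc i = n then 0 else Suc i)"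
  have bounds: "pr < n" "sc < n" "pr \<noteq> sc" using i(1) n3 by (auto simp: pr_def sc_def)
  have "tail G (p ! i) = w pr"
    using tail_0 tail_Suc[of "i - 1"] i(1) by (auto simp: pr_def)
  then have "w pr \<rightarrow>\<^bsub>G\<^esub> w i" using edge[OF i(1)] by simp
  then have "w pr = parent (w i)" using parent i(2)[OF bounds(1)] by fastforce
  moreover have "tail G (p ! sc) = w i"
    using tail_0 tail_Suc[of i] i(1) by (auto simp: sc_def)
  then have "w i \<rightarrow>\<^bsub>G\<^esub> w sc" using edge[OF bounds(2)] by simp
  then have "w sc = parent (w i)" using parent i(2)[OF bounds(2)] by fastforce
  ultimately show False using w_inj bounds by metis
qed

section \<open>Spanning caterpillars\<close>

text \<open>\<open>\<sigma>\<close> lists the spine, and \<open>h u\<close> is the index at which a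
  further vertex \<open>u\<close> hangs. Attachment strictly inside the spine makes both spine ends
  leaves and keeps all distances at most \<open>d\<close>.\<close>

locale spine = graph +
  fixes \<sigma> :: "nat \<Rightarrow> 'a" and d :: nat and h :: "'a \<Rightarrow> nat"
  assumes d_pos: "0 < d"
    and inj_spine: "inj_on \<sigma> {..d}"
    and spine_adj: "\<And>i. i < d \<Longrightarrow> \<sigma> i \<rightarrow>\<^bsub>G\<^esub> \<sigma> (Suc i)"
    and pendant: "\<And>u. u \<in> verts G - \<sigma> ` {..d} \<Longrightarrow> h u \<in> {0<..<d} \<and> \<sigma> (h u) \<rightarrow>\<^bsub>G\<^esub> u"
begin

text \<open>Edges are oriented away from the root \<open>\<sigma> 0\<close>, so that every other
  vertex has a unique predecessor.\<close>

definition down_edges :: "('a \<times> 'a) set" where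
  "down_edges = {(\<sigma> i, \<sigma> (Suc i)) | i. i < d}
     \<union> {(\<sigma> (h u), u) | u. u \<in> verts G - \<sigma> ` {..d}}"

definition edges :: "('a \<times> 'a) set" where
  "edges = down_edges \<union> down_edges\<inverse>"

definition T :: "('a, 'b) pre_digraph" where
  "T = G\<lparr>arcs := {e \<in> arcs G. (tail G e, head G e) \<in> edges}\<rparr>"

lemma T_simps [simp]:
  "verts T = verts G" "tail T = tail G" "head T = head G"
  "arcs T = {e \<in> arcs G. (tail G e, head G e) \<in> edges}"
  by (auto simp: T_def)

lemma sym_edges: "sym edges"
  by (auto simp: edges_def sym_def)

text \<open>The prescribed edges all belong to \<open>G\<close>, so restricting the arcs of
  \<open>G\<close> loses none of them.\<close>

lemma arcs_ends_T: "arcs_ends T = edges"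
proof -
  have "down_edges \<subseteq> arcs_ends G"
    using spine_adj pendant by (auto simp: down_edges_def)
  then have "edges \<subseteq> arcs_ends G"
    using sym_arcs by (auto simp: edges_def symmetric_def sym_def)
  then show ?thesis by (fastforce simp: arcs_ends_conv)
qed

lemma graph_T: "graph T"
proof -
  have "symmetric T" using sym_edges by (simp add: symmetric_def arcs_ends_T)
  then show ?thesis
    by unfold_locales
      (auto simp: no_loops arc_to_ends_def intro: no_multi_arcs)
qed

sublocale T: graph T
  by (rule graph_T)

lemma spanning_T: "spanning T G"
  by (auto simp: spanning_def subgraph_def compatible_def wf_digraph T.wf_digraph)

section \<open>Distances in the caterpillar\<close>

lemma spine_in_verts: "i \<le> d \<Longrightarrow> \<sigma> i \<in> verts G"
  using spine_adj d_pos adj_in_verts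
  by (metis Suc_le_eq Suc_pred le_neq_implies_less)

lemma spine_eq_iff: "i \<le> d \<Longrightarrow> j \<le> d \<Longrightarrow> \<sigma> i = \<sigma> j \<longleftrightarrow> i = j"
  using inj_spine by (auto simp: inj_on_def)

lemma edges_pendant: "u \<in> verts G - \<sigma> ` {..d} \<Longrightarrow> (u, \<sigma> (h u)) \<in> edges"
  by (auto simp: edges_def down_edges_def)

lemma relpow_spine: "i + k \<le> d \<Longrightarrow> (\<sigma> i, \<sigma> (i + k)) \<in> edges ^^ k"
proof (induction k)
  case (Suc k)
  moreover have "(\<sigma> (i + k), \<sigma> (Suc (i + k))) \<in> edges"
    using Suc.prems by (auto simp: edges_def down_edges_def)
  ultimately show ?case by auto
qed simp

text \<open>The offset \<open>e\<close> is 0 or 1. The two inequalities say that it is no longer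
  than the piece of spine from \<open>i\<close> to either end.\<close>

lemma relpow_to_spine:
  assumes "u \<in> verts G"
  obtains i e where "(u, \<sigma> i) \<in> edges ^^ e" "e \<le> i" "i + e \<le> d"
proof (cases "u \<in> \<sigma> ` {..d}")
  case True
  then obtain i where "i \<le> d" "u = \<sigma> i" by auto
  then show thesis using that[of i 0] by simp
next
  case False
  with assms have u: "u \<in> verts G - \<sigma> ` {..d}" by simp
  show thesis using that[of "h u" 1] edges_pendant[OF u] pendant[OF u] by simp
qed

text \<open>A walk through the spine takes at most i + (j - i) + (d - j) = d steps: the offset of
  the left vertex is charged to the spine before \<open>i\<close>, that of the right vertex to the
  spine after \<open>j\<close>.\<close>

lemma relpow_edges:
  assumes "u \<in> verts G" "v \<in> verts G"
  obtains n where "n \<le> d" "(u, v) \<in> edges ^^ n"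
proof -
  have *: "\<exists>n\<le>d. (x, y) \<in> edges ^^ n"
    if x: "(x, \<sigma> i) \<in> edges ^^ e" "e \<le> i" and y: "(y, \<sigma> j) \<in> edges ^^ e'" "j + e' \<le> d"
      and ij: "i \<le> j"
    for x y i j e e'
  proof -
    have "(\<sigma> i, \<sigma> j) \<in> edges ^^ (j - i)" using relpow_spine[of i "j - i"] ij y(2) by simp
    moreover have "(\<sigma> j, y) \<in> edges ^^ e'" by (rule relpow_sym[OF sym_edges y(1)])
    ultimately have "(x, y) \<in> edges ^^ (e + (j - i) + e')"
      using x(1) by (auto simp: relpow_add)
    moreover have "e + (j - i) + e' \<le> d" using x(2) y(2) ij by simp
    ultimately show ?thesis by blast
  qed
  obtain i e where i: "(u, \<sigma> i) \<in> edges ^^ e" "e \<le> i" "i + e \<le> d"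
    using relpow_to_spine[OF assms(1)] .
  obtain j e' where j: "(v, \<sigma> j) \<in> edges ^^ e'" "e' \<le> j" "j + e' \<le> d"
    using relpow_to_spine[OF assms(2)] .
  show thesis
  proof (cases "i \<le> j")
    case True
    then show thesis using *[OF i(1,2) j(1,3)] that by blast
  next
    case False
    then obtain n where "n \<le> d" "(v, u) \<in> edges ^^ n" using *[OF j(1,2) i(1,3)] by auto
    then show thesis using relpow_sym[OF sym_edges] that by blast
  qed
qed

lemma connected_T: "Digraph_Component.connected T"
proof (rule T.connectedI)
  show "verts T \<noteq> {}" using spine_in_verts[of 0] by auto
next
  fix u v assume "u \<in> verts T" "v \<in> verts T"
  then obtain n where "(u, v) \<in> edges ^^ n" using relpow_edges[of u v] by auto
  then have "u \<rightarrow>\<^sup>*\<^bsub>T\<^esub> v"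
    using \<open>u \<in> verts T\<close> \<open>v \<in> verts T\<close>
    by (auto simp: T.reachable_conv arcs_ends_T intro: relpow_imp_rtrancl)
  then show "u \<rightarrow>\<^sup>*\<^bsub>mk_symmetric T\<^esub> v" by (rule T.reachable_mk_symmetricI)
qed

lemma graph_diam_T_le: "graph_diam T \<le> ereal (real d)"
  unfolding graph_diam_def
proof (intro SUP_least)
  fix u v assume "u \<in> verts T" "v \<in> verts T"
  then obtain n where "n \<le> d" "(u, v) \<in> edges ^^ n" using relpow_edges[of u v] by auto
  then show "graph_dist T u v \<le> ereal (real d)"
    using T.graph_dist_le[of u v n] \<open>u \<in> verts T\<close>
    by (auto simp: arcs_ends_T elim: order_trans)
qed

section \<open>Orientation and acyclicity\<close>

definition spine_index :: "'a \<Rightarrow> nat" where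
  "spine_index v = the_inv_into {..d} \<sigma> v"

lemma spine_index_spine [simp]: "i \<le> d \<Longrightarrow> spine_index (\<sigma> i) = i"
  using inj_spine by (simp add: spine_index_def the_inv_into_f_f)

text \<open>\<open>Suc d\<close> exceeds every index on the spine, so each pendant vertex ranks
  above its attachment point.\<close>

definition rank :: "'a \<Rightarrow> nat" where
  "rank v = (if v \<in> \<sigma> ` {..d} then spine_index v else Suc d)"

text \<open>At \<open>\<sigma> 0\<close> truncated subtraction returns \<open>\<sigma> 0\<close>
  itself; no downward edge ends there.\<close>

definition parent :: "'a \<Rightarrow> 'a" where
  "parent v = (if v \<in> \<sigma> ` {..d} then \<sigma> (spine_index v - 1) else \<sigma> (h v))"

lemma down_edgesE:
  assumes "(u, v) \<in> down_edges"
  obtains (spine_arc) i where "i < d" "u = \<sigma> i" "v = \<sigma> (Suc i)"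
    | (pendant_arc) "v \<in> verts G - \<sigma> ` {..d}" "h v \<in> {0<..<d}" "u = \<sigma> (h v)"
proof -
  consider i where "i < d" "u = \<sigma> i" "v = \<sigma> (Suc i)"
    | "v \<in> verts G - \<sigma> ` {..d}" "u = \<sigma> (h v)"
    using assms unfolding down_edges_def by blast
  then show thesis
  proof cases
    case 1
    then show thesis by (rule that(1))
  next
    case 2
    then show thesis using that(2) pendant by blast
  qed
qed

text \<open>Puts the orientation in the form required by \<open>no_long_cycle_if_parent\<close>;
  uniqueness of predecessors serves again in \<open>leaves_T\<close>.\<close>

lemma down_edges_parent:
  assumes "(u, v) \<in> down_edges"
  shows "rank u < rank v \<and> u = parent v"
  using assms by (cases rule: down_edgesE) (auto simp: rank_def parent_def)

lemma undirected_tree_T: "undirected_tree T"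
proof -
  have "length p < 3" if "pre_digraph.cycle T p" for p
    using that down_edges_parent
    by (intro T.no_long_cycle_if_parent[of rank parent]) (auto simp: arcs_ends_T edges_def)
  then show ?thesis
    using graph_T connected_T by (auto simp: undirected_tree_def not_le)
qed

text \<open>An inner spine vertex has two different spine neighbours. A spine end has only one
  neighbour because pendant vertices avoid it, and a pendant vertex has only its attachment
  point.\<close>

lemma leaves_T: "leaves T = verts G - \<sigma> ` {0<..<d}"
proof -
  have deg: "out_degree T v = card (edges `` {v})" for v
    by (simp add: T.out_degree_eq_card_Image arcs_ends_T)
  have inner: "out_degree T (\<sigma> i) \<noteq> 1" if i: "0 < i" "i < d" for i
  proof
    assume "out_degree T (\<sigma> i) = 1"
    then obtain w where w: "edges `` {\<sigma> i} = {w}" by (auto simp: deg card_1_singleton_iff)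
    obtain k where k: "i = Suc k" using i(1) by (cases i) auto
    then have "(\<sigma> i, \<sigma> (Suc i)) \<in> down_edges" "(\<sigma> k, \<sigma> i) \<in> down_edges"
      using i by (auto simp: down_edges_def)
    then have "\<sigma> (Suc i) = w" "\<sigma> k = w" using w unfolding edges_def by blast+
    then show False using spine_eq_iff[of "Suc i" k] i k by simp
  qed
  have "edges `` {\<sigma> 0} = {\<sigma> 1}"
  proof -
    have "w = \<sigma> 1" if "(\<sigma> 0, w) \<in> down_edges" for w
      using that by (cases rule: down_edgesE) (auto simp: spine_eq_iff)
    moreover have "(w, \<sigma> 0) \<notin> down_edges" for w
      using down_edges_parent[of w "\<sigma> 0"] by (auto simp: rank_def)
    moreover have "(\<sigma> 0, \<sigma> 1) \<in> down_edges" using d_pos by (auto simp: down_edges_def)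
    ultimately show ?thesis unfolding edges_def by blast
  qed
  then have first: "out_degree T (\<sigma> 0) = 1" by (simp add: deg)
  have "edges `` {\<sigma> d} = {\<sigma> (d - 1)}"
  proof -
    \<comment> \<open>Spine edges start at indices below \<open>d\<close>, and attachment points
      have indices below \<open>d\<close> as well.\<close>
    have "(\<sigma> d, w) \<notin> down_edges" for w
    proof
      assume "(\<sigma> d, w) \<in> down_edges"
      then show False by (cases rule: down_edgesE) (auto simp: spine_eq_iff)
    qed
    moreover have "w = \<sigma> (d - 1)" if "(w, \<sigma> d) \<in> down_edges" for w
      using down_edges_parent[OF that] by (simp add: parent_def)
    moreover have "(\<sigma> (d - 1), \<sigma> (Suc (d - 1))) \<in> down_edges"
      using d_pos unfolding down_edges_def by fastforce
    then have "(\<sigma> (d - 1), \<sigma> d) \<in> down_edges" using d_pos by simp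
    ultimately show ?thesis unfolding edges_def by blast
  qed
  then have last: "out_degree T (\<sigma> d) = 1" by (simp add: deg)
  have pend: "out_degree T u = 1" if u: "u \<in> verts G - \<sigma> ` {..d}" for u
  proof -
    have "(u, w) \<notin> down_edges" for w
    proof
      assume "(u, w) \<in> down_edges"
      then show False using u by (cases rule: down_edgesE) auto
    qed
    moreover have "w = \<sigma> (h u)" if "(w, u) \<in> down_edges" for w
      using down_edges_parent[OF that] u by (simp add: parent_def)
    moreover have "(\<sigma> (h u), u) \<in> down_edges" using u by (auto simp: down_edges_def)
    ultimately have "edges `` {u} = {\<sigma> (h u)}" unfolding edges_def by blast
    then show ?thesis by (simp add: deg)
  qed
  show ?thesis
  proof (intro set_eqI iffI)
    fix v assume "v \<in> leaves T"
    then show "v \<in> verts G - \<sigma> ` {0<..<d}" using inner by (auto simp: leaves_def)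
  next
    fix v assume v: "v \<in> verts G - \<sigma> ` {0<..<d}"
    show "v \<in> leaves T"
    proof (cases "v \<in> \<sigma> ` {..d}")
      case True
      then obtain i where "i \<le> d" "v = \<sigma> i" by auto
      then have "i = 0 \<or> i = d" using v by force
      then show ?thesis using v first last \<open>v = \<sigma> i\<close> by (auto simp: leaves_def)
    next
      case False
      then show ?thesis using v pend by (simp add: leaves_def)
    qed
  qed
qed

text \<open>Without its leaves \<open>T\<close> is the inner spine, as every pendant edge has lost
  an end. For d = 1 the list \<open>?p\<close> is empty, which \<open>path_graph\<close>
  admits.\<close>

lemma caterpillar_T: "caterpillar T"
proof -
  let ?V = "\<sigma> ` {0<..<d}"
  let ?P = "T \<restriction> ?V"
  let ?p = "map \<sigma> [1..<d]"
  have V: "verts T - leaves T = ?V" using leaves_T spine_in_verts by auto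
  have ends: "arcs_ends ?P = edges \<inter> (?V \<times> ?V)"
    unfolding arcs_ends_T[symmetric] by (force simp: arcs_ends_conv induce_subgraph_def)
  have "graph ?P"
  proof -
    have "symmetric ?P" using sym_edges by (auto simp: symmetric_def ends sym_def)
    then show ?thesis
      by unfold_locales
        (auto simp: induce_subgraph_def no_loops arc_to_ends_def spine_in_verts intro: no_multi_arcs)
  qed
  moreover have "distinct ?p"
    using inj_spine by (auto simp: distinct_map inj_on_def)
  moreover have "verts ?P = set ?p" by auto
  moreover have "set (vwalk_arcs ?p) = {(\<sigma> i, \<sigma> (Suc i)) | i. 0 < i \<and> Suc i < d}"
    (is "_ = ?W")
  proof -
    have "(\<sigma> i, \<sigma> (Suc i)) \<in> set (vwalk_arcs ?p)" if "0 < i" "Suc i < d" for i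
      \<comment> \<open>The list starts at spine index 1, hence the position
        \<open>i - 1\<close>.\<close>
      using that by (auto simp: set_vwalk_arcs intro!: exI[of _ "i - 1"])
    then show ?thesis by (auto simp: set_vwalk_arcs)
  qed
  moreover have "down_edges \<inter> (?V \<times> ?V) = ?W"
  proof
    show "down_edges \<inter> (?V \<times> ?V) \<subseteq> ?W"
    proof clarify
      fix i j assume e: "(\<sigma> i, \<sigma> j) \<in> down_edges" and ij: "i \<in> {0<..<d}" "j \<in> {0<..<d}"
      from e show "\<exists>k. (\<sigma> i, \<sigma> j) = (\<sigma> k, \<sigma> (Suc k)) \<and> 0 < k \<and> Suc k < d"
      proof (cases rule: down_edgesE)
        case (spine_arc k)
        then have "i = k" "j = Suc k" using ij by (auto simp: spine_eq_iff)
        then show ?thesis using ij by auto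
      next
        case pendant_arc
        then show ?thesis using ij by auto
      qed
    qed
    show "?W \<subseteq> down_edges \<inter> (?V \<times> ?V)" by (auto simp: down_edges_def)
  qed
  then have "arcs_ends ?P = ?W \<union> ?W\<inverse>"
    unfolding ends edges_def by blast
  ultimately have "path_graph ?P" unfolding path_graph_def by (intro conjI exI[of _ ?p]) simp_all
  then show ?thesis using undirected_tree_T V by (simp add: caterpillar_def)
qed

end

section \<open>Levels of an optimal total dominating set\<close>

text \<open>
  Every level \<open>i \<le> d\<close> not adjacent to an occupied level is occupied itself, hence isolated
  among the occupied levels, hence carries two elements. With \<open>A\<close> the occupied and \<open>I\<close> the
  isolated levels this gives \<open>d + 1 \<le> 2|A| + |I|\<close> and \<open>|A| + |I| \<le> |S|\<close>, so \<open>2|S| = d + 1\<close>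
  forces \<open>I = {}\<close> and every level in \<open>{0..d}\<close>, and no other, to have exactly one neighbour in \<open>A\<close>.
\<close>

lemma tight_levels:
  fixes f :: "'a \<Rightarrow> nat"
  assumes fin: "finite S" and card_S: "2 * card S = d + 1"
    and cover: "\<And>i. i \<le> d \<Longrightarrow> \<exists>s\<in>S. f s \<le> Suc i \<and> i \<le> Suc (f s)"
    and partner: "\<And>s. s \<in> S \<Longrightarrow> \<exists>t\<in>S. t \<noteq> s \<and> f t \<le> Suc (f s) \<and> f s \<le> Suc (f t)"
  shows "inj_on f S" "0 \<notin> f ` S" "d \<notin> f ` S" "\<And>i. i \<in> f ` S \<Longrightarrow> Suc (Suc i) \<notin> f ` S"
proof -
  define A where "A = f ` S"
  define A2 where "A2 = (\<lambda>i. Suc (Suc i)) ` A"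
  \<comment> \<open>The quantifier over \<open>j\<close> says that level \<open>i - 1\<close> is
    unoccupied, without truncation at 0.\<close>
  define I where "I = {i \<in> A. Suc i \<notin> A \<and> (\<forall>j. i = Suc j \<longrightarrow> j \<notin> A)}"
  have finA: "finite A" "finite A2" "finite I" using fin by (auto simp: A_def A2_def I_def)
  \<comment> \<open>Shifting levels up by one avoids predecessors: being near an occupied level
    means lying in \<open>A\<close>, its shift by one, or \<open>A2\<close>. If an occupied level is
    not isolated, an occupied neighbour already covers it through \<open>A\<close> or
    \<open>A2\<close>, so of the middle shift only that of \<open>I\<close> remains.\<close>
  have cover': "{Suc 0..Suc d} \<subseteq> A \<union> A2 \<union> Suc ` I"
  proof
    fix m assume "m \<in> {Suc 0..Suc d}"
    then obtain i where i: "m = Suc i" "i \<le> d" by (cases m) auto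
    then obtain s where s: "s \<in> S" "f s \<le> Suc i" "i \<le> Suc (f s)" using cover by blast
    have "f s \<in> A" using s by (auto simp: A_def)
    consider "f s = Suc i" | "i = f s" | "i = Suc (f s)" using s by linarith
    then show "m \<in> A \<union> A2 \<union> Suc ` I"
      using \<open>f s \<in> A\<close> i(1) by cases (auto simp: A2_def I_def)
  qed
  have "card A2 \<le> card A" unfolding A2_def by (rule card_image_le[OF finA(1)])
  moreover have "card (Suc ` I) = card I" by (simp add: card_image)
  moreover have "d + 1 \<le> card (A \<union> A2 \<union> Suc ` I)"
    using card_mono[OF _ cover'] finA by simp
  ultimately have upper: "d + 1 \<le> 2 * card A + card I"
    using card_Un_le[of "A \<union> A2" "Suc ` I"] card_Un_le[of A A2] by linarith
  have fiber: "1 + of_bool (i \<in> I) \<le> card {s \<in> S. f s = i}" if i: "i \<in> A" for i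
  proof -
    obtain s where s: "s \<in> S" "f s = i" using i by (auto simp: A_def)
    show ?thesis
    proof (cases "i \<in> I")
      case True
      obtain t where t: "t \<in> S" "t \<noteq> s" "f t \<le> Suc (f s)" "f s \<le> Suc (f t)"
        using partner[OF s(1)] by blast
      have "f t \<in> A" using t by (auto simp: A_def)
      then have "f t = i" using t(3,4) s(2) True by (auto simp: I_def le_Suc_eq)
      then have "{s, t} \<subseteq> {s \<in> S. f s = i}" using s t by auto
      then have "card {s, t} \<le> card {s \<in> S. f s = i}" using fin by (intro card_mono) auto
      then show ?thesis using t(2) True by simp
    next
      case False
      have "card {s \<in> S. f s = i} > 0" using s fin by (auto simp: card_gt_0_iff)
      then show ?thesis using False by simp
    qed
  qed
  have "card S = (\<Sum>i\<in>A. card {s \<in> S. f s = i})"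
    using sum_fun_comp[OF fin finA(1), of f "\<lambda>_. 1::nat"] by (simp add: A_def)
  also have "\<dots> \<ge> (\<Sum>i\<in>A. 1 + of_bool (i \<in> I))" by (intro sum_mono fiber)
  also have "(\<Sum>i\<in>A. 1 + of_bool (i \<in> I)) = card A + card (A \<inter> I)"
    unfolding sum.distrib using finA(1) by simp
  also have "A \<inter> I = I" by (auto simp: I_def)
  finally have "card A + card I \<le> card S" .
  with upper card_S have eqs: "card I = 0" "card A = card S" by linarith+
  then have "I = {}" using finA by simp
  show "inj_on f S" using eqs(2) fin by (intro eq_card_imp_inj_on) (auto simp: A_def)
  have sub: "{Suc 0..Suc d} \<subseteq> A \<union> A2" using cover' \<open>I = {}\<close> by simp
  \<comment> \<open>\<open>A\<close> and \<open>A2\<close> together have at most 2 |A| = d + 1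
    elements, just enough for the interval; so they are disjoint and fill it exactly.\<close>
  have "card (A \<union> A2) + card (A \<inter> A2) = card A + card A2"
    using card_Un_Int[OF finA(1,2)] by simp
  moreover have "d + 1 \<le> card (A \<union> A2)" using card_mono[OF _ sub] finA by simp
  ultimately have "card (A \<inter> A2) = 0" "card (A \<union> A2) = d + 1"
    using \<open>card A2 \<le> card A\<close> eqs card_S by linarith+
  then have disj: "A \<inter> A2 = {}" and eq: "{Suc 0..Suc d} = A \<union> A2"
    using finA card_subset_eq[OF _ sub] by auto
  \<comment> \<open>Both 0 and d + 2 lie outside the interval; d + 2 in \<open>A2\<close> is
    \<open>d\<close> in \<open>A\<close> before the shift.\<close>
  have "0 \<notin> A" "Suc (Suc d) \<notin> A2" using eq by (metis UnCI atLeastAtMost_iff not_less_eq_eq le_refl)+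
  then show "0 \<notin> f ` S" "d \<notin> f ` S" by (auto simp: A_def A2_def)
  show "Suc (Suc i) \<notin> f ` S" if "i \<in> f ` S" for i
    using disj that by (auto simp: A_def A2_def)
qed

section \<open>Total dominating sets of minimum size\<close>

lemma obtain_min_total_dominating_set:
  assumes "total_dominating_set G S\<^sub>0"
  obtains S where "total_dominating_set G S" "card S = total_domination_number G"
  using LeastI_ex[of "\<lambda>k. \<exists>S. total_dominating_set G S \<and> card S = k"] assms
  unfolding total_domination_number_def by blast

text \<open>Connectedness and a second vertex exclude isolated vertices; thus the minimum in
  \<open>total_domination_number\<close> is over a nonempty family.\<close>

lemma (in graph) verts_total_dominating:
  assumes "Digraph_Component.connected G" "2 \<le> card (verts G)"
  shows "total_dominating_set G (verts G)"
  unfolding total_dominating_set_def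
proof (intro conjI ballI)
  fix v assume v: "v \<in> verts G"
  have "verts G \<noteq> {v}" using assms(2) by auto
  then obtain w where w: "w \<in> verts G" "w \<noteq> v" using v by blast
  have "strongly_connected G"
    using assms(1) sym_arcs by (rule symmetric_connected_imp_strongly_connected[rotated])
  then have "v \<rightarrow>\<^sup>*\<^bsub>G\<^esub> w" using v w by (auto simp: strongly_connected_def)
  then show "\<exists>u\<in>verts G. v \<rightarrow>\<^bsub>G\<^esub> u"
    using w(2) by (cases rule: converse_reachable_cases) (auto dest: adj_in_verts)
qed simp

theorem theorem3p4:
  fixes G :: "('a, 'b) pre_digraph"
  assumes "graph G"
    and "Digraph_Component.connected G"
    and "2 \<le> card (verts G)"
    and "ereal (real (total_domination_number G)) = 1 / 2 * (graph_diam G + 1)"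
  shows "\<exists>T. undirected_spanning_tree T G \<and> caterpillar T \<and> graph_diam T = graph_diam G"
proof -
  interpret graph G by (rule assms(1))
  obtain d v\<^sub>0 v\<^sub>1 where diam: "graph_diam G = ereal (real d)"
    and v\<^sub>0: "v\<^sub>0 \<in> verts G" and v\<^sub>1: "v\<^sub>1 \<in> verts G" "hop_dist G v\<^sub>0 v\<^sub>1 = d"
    and hop_le: "\<And>u v. u \<in> verts G \<Longrightarrow> v \<in> verts G \<Longrightarrow> hop_dist G u v \<le> d"
    using graph_diam_attained[OF assms(2)] by blast
  obtain S where S: "total_dominating_set G S" "card S = total_domination_number G"
    using obtain_min_total_dominating_set verts_total_dominating[OF assms(2,3)] by blast
  have "ereal (real (card S)) = ereal ((real d + 1) / 2)"
    using assms(4) by (simp add: S(2) diam flip: one_ereal_def)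
  then have "2 * real (card S) = real (d + 1)" by simp
  then have card_S: "2 * card S = d + 1" by linarith
  have S_verts: "S \<subseteq> verts G" and dominated: "\<And>v. v \<in> verts G \<Longrightarrow> \<exists>s\<in>S. v \<rightarrow>\<^bsub>G\<^esub> s"
    using S(1) by (auto simp: total_dominating_set_def)
  have fin: "finite S" using S_verts finite_subset finite_verts by blast
  have adj_sym: "v \<rightarrow>\<^bsub>G\<^esub> u" if "u \<rightarrow>\<^bsub>G\<^esub> v" for u v
    using sym_arcs that by (rule arcs_ends_symmetric)

  \<comment> \<open>Levels along a diametral path\<close>
  define f where "f = hop_dist G v\<^sub>0"
  have relpow_f: "(v\<^sub>0, u) \<in> arcs_ends G ^^ f u" if "u \<in> verts G" for u
    unfolding f_def by (rule relpow_hop_dist[OF assms(2) v\<^sub>0 that])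
  have f_le: "f u \<le> n" if "(v\<^sub>0, u) \<in> arcs_ends G ^^ n" for u n
    unfolding f_def using that by (rule hop_dist_le)
  \<comment> \<open>Together with \<open>adj_sym\<close>, levels of adjacent vertices differ by at
    most one.\<close>
  have f_adj: "f v \<le> Suc (f u)" if "u \<rightarrow>\<^bsub>G\<^esub> v" for u v
    using relpow_f[of u] adj_in_verts(1)[OF that] that by (intro f_le) auto
  obtain \<pi> where \<pi>: "\<pi> 0 = v\<^sub>0" "\<pi> d = v\<^sub>1" "\<And>i. i < d \<Longrightarrow> \<pi> i \<rightarrow>\<^bsub>G\<^esub> \<pi> (Suc i)"
    using relpow_f[OF v\<^sub>1(1)] v\<^sub>1(2) unfolding f_def relpow_fun_conv by auto
  have f_\<pi>: "f (\<pi> i) = i" if "i \<le> d" for i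
  proof -
    have "(\<pi> 0, \<pi> i) \<in> arcs_ends G ^^ i"
      using \<pi>(3) that by (auto simp: relpow_fun_conv intro!: exI[of _ \<pi>])
    then have "f (\<pi> i) \<le> i" using f_le \<pi>(1) by simp
    \<comment> \<open>Induction downwards from \<open>\<pi> d\<close> on level \<open>d\<close>: one
      step back lowers the level by at most one.\<close>
    moreover have "d \<le> f (\<pi> i) + (d - i)"
      using that
    proof (induction rule: inc_induct)
      case base
      then show ?case using \<pi>(2) v\<^sub>1(2) by (simp add: f_def)
    next
      case (step k)
      then show ?case using f_adj[OF \<pi>(3)[OF step(2)]] by linarith
    qed
    ultimately show ?thesis using that by linarith
  qed
  have \<pi>_verts: "\<pi> i \<in> verts G" if "i \<le> d" for i
    using \<pi>(2) v\<^sub>1(1) that adj_in_verts(1)[OF \<pi>(3)] by (cases "i = d") auto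

  \<comment> \<open>The witness is a vertex of \<open>S\<close> dominating \<open>\<pi> i\<close>;
    for \<open>partner\<close> it dominates \<open>s\<close> and differs from it by absence of
    loops.\<close>
  have cover: "\<exists>s\<in>S. f s \<le> Suc i \<and> i \<le> Suc (f s)" if "i \<le> d" for i
    using dominated[OF \<pi>_verts[OF that]] f_adj adj_sym f_\<pi>[OF that] by metis
  have partner: "\<exists>t\<in>S. t \<noteq> s \<and> f t \<le> Suc (f s) \<and> f s \<le> Suc (f t)" if "s \<in> S" for s
    using dominated[of s] that S_verts f_adj adj_sym adj_not_same by (metis subsetD)
  have levels: "inj_on f S" "0 \<notin> f ` S" "d \<notin> f ` S" "\<And>i. i \<in> f ` S \<Longrightarrow> Suc (Suc i) \<notin> f ` S"
    using tight_levels[OF fin card_S cover partner] by blast+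

  \<comment> \<open>Rerouting the path through the dominating set\<close>
  define \<sigma> where "\<sigma> i = (if i \<in> f ` S then the_inv_into S f i else \<pi> i)" for i
  have \<sigma>_f [simp]: "\<sigma> (f s) = s" if "s \<in> S" for s
    using that levels(1) by (simp add: \<sigma>_def the_inv_into_f_f)
  have f_\<sigma>: "f (\<sigma> i) = i" if "i \<le> d" for i
    using that f_\<pi> levels(1) by (auto simp: \<sigma>_def the_inv_into_f_f)
  have f_S: "f s \<in> {0<..<d}" if "s \<in> S" for s
  proof -
    have "f s \<le> d" unfolding f_def using hop_le v\<^sub>0 S_verts that by blast
    moreover have "f s \<noteq> 0" "f s \<noteq> d" using levels(2,3) that by (metis imageI)+
    ultimately show ?thesis by simp
  qed
  \<comment> \<open>In the cases with an occupied level, \<open>levels\<close> forces a vertex of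
    \<open>S\<close> dominating a suitable vertex onto one particular level, where it must be the
    value of \<open>\<sigma>\<close>.\<close>
  have \<sigma>_adj: "\<sigma> i \<rightarrow>\<^bsub>G\<^esub> \<sigma> (Suc i)" if i: "i < d" for i
  proof (cases "i \<in> f ` S")
    case True
    then obtain s where s: "s \<in> S" "f s = i" by auto
    define u where "u = \<sigma> (Suc i)"
    have u: "f u = Suc i" "u \<in> verts G"
      using f_\<sigma>[of "Suc i"] i S_verts \<pi>_verts[of "Suc i"] levels(1)
      by (auto simp: u_def \<sigma>_def the_inv_into_f_f)
    show ?thesis
    proof (cases "Suc i \<in> f ` S")
      case False
      \<comment> \<open>A dominator of \<open>u\<close> is on level i, i + 1 or i + 2; the second is
        unoccupied and the third is at distance two from the occupied level i.\<close>
      obtain t where t: "t \<in> S" "u \<rightarrow>\<^bsub>G\<^esub> t" using dominated[OF u(2)] by blast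
      have "f t \<le> Suc (Suc i)" "i \<le> f t"
        using f_adj[OF t(2)] f_adj[OF adj_sym[OF t(2)]] u(1) by auto
      moreover have "f t \<noteq> Suc i" "f t \<noteq> Suc (Suc i)"
        using False t(1) levels(4)[OF True] by (metis imageI)+
      ultimately have "f t = f s" using s(2) by linarith
      then have "t = \<sigma> i" using \<sigma>_f[OF t(1)] s(2) by simp
      then show ?thesis using adj_sym[OF t(2)] by (simp add: u_def)
    next
      case True' : True
      \<comment> \<open>A dominator of \<open>s\<close> is not on level i, where \<open>s\<close> is
        the only vertex of \<open>S\<close>, nor on level i - 1, as i + 1 is occupied.\<close>
      obtain t where t: "t \<in> S" "s \<rightarrow>\<^bsub>G\<^esub> t" using dominated s(1) S_verts by blast
      have "f t \<le> Suc i" "i \<le> Suc (f t)"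
        using f_adj[OF t(2)] f_adj[OF adj_sym[OF t(2)]] s(2) by auto
      moreover have "f t \<noteq> i"
        using t s levels(1) adj_not_same by (metis inj_onD)
      moreover have "Suc (Suc (f t)) \<noteq> Suc i"
        using True' levels(4)[of "f t"] t(1) by auto
      ultimately have "f t = Suc i" by linarith
      then have "t = \<sigma> (Suc i)" using \<sigma>_f[OF t(1)] by simp
      then show ?thesis using t(2) s \<sigma>_f[OF s(1)] by simp
    qed
  next
    case False
    show ?thesis
    proof (cases "Suc i \<in> f ` S")
      case True
      \<comment> \<open>Level i is unoccupied and level i - 1 is excluded by the occupied level i +
        1.\<close>
      obtain t where t: "t \<in> S" "\<pi> i \<rightarrow>\<^bsub>G\<^esub> t" using dominated \<pi>_verts i by (meson less_imp_le)
      have "f t \<le> Suc i" "i \<le> Suc (f t)"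
        using f_adj[OF t(2)] f_adj[OF adj_sym[OF t(2)]] f_\<pi>[of i] i by auto
      moreover have "f t \<noteq> i" using False t(1) by auto
      moreover have "Suc (Suc (f t)) \<noteq> Suc i"
        using True levels(4)[of "f t"] t(1) by auto
      ultimately have "f t = Suc i" by linarith
      then have "t = \<sigma> (Suc i)" using \<sigma>_f[OF t(1)] by simp
      then show ?thesis using t(2) False by (simp add: \<sigma>_def)
    next
      case False' : False
      then show ?thesis using False \<pi>(3)[OF i] by (simp add: \<sigma>_def)
    qed
  qed

  \<comment> \<open>Building the spanning caterpillar\<close>
  have "\<forall>u\<in>verts G. \<exists>k. k \<in> {0<..<d} \<and> \<sigma> k \<rightarrow>\<^bsub>G\<^esub> u"
  proof
    fix u assume "u \<in> verts G"
    \<comment> \<open>The dominator \<open>s\<close> equals \<open>\<sigma> (f s)\<close>, an inner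
      vertex of the new path.\<close>
    then obtain s where "s \<in> S" "u \<rightarrow>\<^bsub>G\<^esub> s" using dominated by blast
    then show "\<exists>k. k \<in> {0<..<d} \<and> \<sigma> k \<rightarrow>\<^bsub>G\<^esub> u"
      using f_S adj_sym by (intro exI[of _ "f s"]) auto
  qed
  then obtain h where h: "\<And>u. u \<in> verts G \<Longrightarrow> h u \<in> {0<..<d} \<and> \<sigma> (h u) \<rightarrow>\<^bsub>G\<^esub> u"
    by metis

  \<comment> \<open>For d = 0 the equation would read 2 |S| = 1.\<close>
  have "0 < d" using card_S by (cases d) auto
  moreover have "inj_on \<sigma> {..d}" by (rule inj_on_inverseI[of _ f]) (simp add: f_\<sigma>)
  ultimately interpret spine G \<sigma> d h
    using \<sigma>_adj h by unfold_locales auto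
  have "\<sigma> 0 = v\<^sub>0" "\<sigma> d = v\<^sub>1" using levels(2,3) \<pi> by (simp_all add: \<sigma>_def)
  have "graph_diam T = graph_diam G"
  proof (rule antisym)
    show "graph_diam T \<le> graph_diam G" using graph_diam_T_le diam by simp
    \<comment> \<open>Walks in \<open>T\<close> are walks in \<open>G\<close>, so the diametral pair
      stays at distance at least \<open>d\<close>.\<close>
    have "edges \<subseteq> arcs_ends G" unfolding arcs_ends_T[symmetric] by (auto simp: arcs_ends_conv)
    then have "d \<le> n" if "(v\<^sub>0, v\<^sub>1) \<in> edges ^^ n" for n
      using f_le[of v\<^sub>1 n] v\<^sub>1(2) relpow_mono[of edges "arcs_ends G" n] that by (auto simp: f_def)
    then have "ereal (real d) \<le> graph_dist T v\<^sub>0 v\<^sub>1"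
      using v\<^sub>0 by (intro T.graph_dist_ge) (auto simp: arcs_ends_T)
    also have "\<dots> \<le> graph_diam T"
      unfolding graph_diam_def
      using v\<^sub>0 v\<^sub>1(1)
      by (intro SUP_upper2[of v\<^sub>0 _ _ "\<lambda>u. SUP v\<in>verts T. graph_dist T u v"] SUP_upper)
        simp_all
    finally show "graph_diam G \<le> graph_diam T" by (simp add: diam)
  qed
  then show ?thesis
    using undirected_tree_T spanning_T caterpillar_T
    by (auto simp: undirected_spanning_tree_def)
qed

end
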